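(* Let $d\in\mathbb{N}$ and let $E\subset\mathbb{C}^d$ be a compact set. Suppose that for each $j=1,\ldots,d$ there is an infinite set $M_j\subset\mathbb{N}$ and, for each $m_j\in M_j$, a complete set of conjugate algebraic numbers $\Lambda_j(m_j)\subset\mathbb{C}$ of cardinality $|\Lambda_j(m_j)|=m_j$, such that \[ \Lambda_1(m_1)\times\cdots\times\Lambda_d(m_d)\subset E\qquad\text{for all } m_1\in M_1,\ldots,m_d\in M_d. \] Denote by $a_j(m_j)\in\mathbb{Z}$ the leading coefficient of the minimal polynomial for $\Lambda_j(m_j)$, and set \[ s_j:=\limsup_{m_j\to\infty,\ m_j\in M_j}|a_j(m_j)|^{-1/m_j},\qquad j=1,\ldots,d. \] Then \[ t_{\mathbb{Z}}(E)\ge\prod_{j=1}^d s_j. \]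
   Context: $\mathcal{P}_n^d(\mathbb{Z})$ is the set of polynomials $\sum_{|k|\le n}a_kz^k$ in $d$ complex variables of (total) degree at most $n$ with integer coefficients, where $k\in\mathbb{N}_0^d$, $|k|=\sum_i k_i$, $z^k=z_1^{k_1}\cdots z_d^{k_d}$. For compact $E\subset\mathbb{C}^d$, $\|f\|_E:=\sup_{z\in E}|f(z)|$, $t_{\mathbb{Z}}(n,E):=\inf\{\|P\|_E:P\in\mathcal{P}_n^d(\mathbb{Z}),\ P\not\equiv0\}$, and the integer Chebyshev constant is $t_{\mathbb{Z}}(E):=\lim_{n\to\infty}t_{\mathbb{Z}}(n,E)^{1/n}$. A complete set of conjugate algebraic numbers is the set of all complex roots of the minimal polynomial of some algebraic number; here the minimal polynomial is taken with integer coefficients, i.e. irreducible over $\mathbb{Q}$ and primitive (coprime integer coefficients), so its leading coefficient is a nonzero integer determined up to sign. *)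

theory Defs
  imports
    "HOL-Analysis.Analysis"
    "HOL-Library.Poly_Mapping"
    "HOL-Computational_Algebra.Computational_Algebra"
begin

text \<open>
  Formal polynomials in the variables indexed by 'd: exponent vectors are mapped to coefficients.
\<close>

type_synonym 'd int_mpoly = "('d \<Rightarrow>\<^sub>0 nat) \<Rightarrow>\<^sub>0 int"

definition exp_degree :: "('d::finite \<Rightarrow>\<^sub>0 nat) \<Rightarrow> nat" where
  "exp_degree k = (\<Sum>i\<in>UNIV. Poly_Mapping.lookup k i)"

definition int_polys :: "nat \<Rightarrow> ('d::finite) int_mpoly set" where
  "int_polys n = {P. \<forall>k\<in>Poly_Mapping.keys P. exp_degree k \<le> n}"

definition mpoly_eval :: "('d::finite) int_mpoly \<Rightarrow> complex ^ 'd \<Rightarrow> complex" where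
  "mpoly_eval P z = (\<Sum>k\<in>Poly_Mapping.keys P. of_int (Poly_Mapping.lookup P k) * (\<Prod>i\<in>UNIV. (z $ i) ^ Poly_Mapping.lookup k i))"

text \<open>
  The supremum and infimum below are taken in the reals, so they are meaningful for nonempty
  compact sets.
\<close>

definition sup_norm_on :: "(complex ^ 'd) set \<Rightarrow> (complex ^ 'd \<Rightarrow> complex) \<Rightarrow> real" where
  "sup_norm_on E f = (SUP z\<in>E. norm (f z))"

definition int_cheb_num :: "nat \<Rightarrow> (complex ^ 'd::finite) set \<Rightarrow> real" where
  "int_cheb_num n E = (INF P\<in>int_polys n - {0}. sup_norm_on E (mpoly_eval P))"

definition int_cheb_const :: "(complex ^ 'd::finite) set \<Rightarrow> real" where
  "int_cheb_const E = lim (\<lambda>n. root n (int_cheb_num n E))"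

text \<open>
  Minimal polynomials are taken over the integers: primitive and irreducible over the rationals.
  They are determined up to sign, so being one is a relation.
\<close>

definition is_int_min_poly :: "int poly \<Rightarrow> complex \<Rightarrow> bool" where
  "is_int_min_poly p \<alpha> \<longleftrightarrow>
     irreducible (map_poly of_int p :: rat poly) \<and> content p = 1 \<and> poly (map_poly of_int p) \<alpha> = 0"

definition is_min_poly_for :: "int poly \<Rightarrow> complex set \<Rightarrow> bool" where
  "is_min_poly_for p L \<longleftrightarrow>
     (\<exists>\<alpha>. algebraic \<alpha> \<and> is_int_min_poly p \<alpha> \<and> L = {z. poly (map_poly of_int p) z = 0})"

definition complete_conjugate_set :: "complex set \<Rightarrow> bool" where
  "complete_conjugate_set L \<longleftrightarrow> (\<exists>p. is_min_poly_for p L)"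

text \<open>
  The limit superior along m tending to infinity within M. It is taken in the extended reals
  because Limsup needs a complete lattice.
\<close>

definition limsup_along :: "nat set \<Rightarrow> (nat \<Rightarrow> real) \<Rightarrow> ereal" where
  "limsup_along M f = Limsup (inf sequentially (principal M)) (\<lambda>m. ereal (f m))"

end

theory Submission
  imports
    Defs
    "HOL-Computational_Algebra.Field_as_Ring"
    "Jordan_Normal_Form.Char_Poly"
begin

text \<open>
  Let \<open>P\<close> be a nonzero integer polynomial of degree at most \<open>n\<close>, and let \<open>p\<close> be the minimal polynomial,
  with leading coefficient \<open>a\<close>, of a complete set \<open>L\<close> of \<open>m\<close> conjugates. Taking the norm of \<open>P\<close> in the
  variable \<open>z\<^sub>i\<close>, that is, the product of the polynomials obtained by substituting the elements of \<open>L\<close>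
  for \<open>z\<^sub>i\<close>, and multiplying it by \<open>a ^ n\<close>, gives the resultant of \<open>p\<close> and \<open>P\<close> with respect to \<open>z\<^sub>i\<close>:
  a polynomial \<open>Q\<close> with integer coefficients in the other variables, of degree at most \<open>n * m\<close>. If
  \<open>m > n\<close>, then no element of \<open>L\<close> is a root of a nonzero integer polynomial of degree at most \<open>n\<close>, so
  no factor of the norm vanishes and \<open>Q\<close> is not zero (\<open>partial_norm\<close>).

  Eliminating the variables in turn, each with a conjugate set whose size exceeds the degree reached
  so far, leaves a nonzero integer, of absolute value at least \<open>1\<close>. Going back up, the largest of the
  factors of a norm is at least their geometric mean. Every elimination thus divides the \<open>n\<close>-th root
  of the lower bound by \<open>\<bar>a\<bar> powr (1 / m)\<close>, and as only finitely many sizes \<open>m\<close> are excluded, this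
  number may be taken below \<open>1 / c\<^sub>j\<close> whenever \<open>0 < c\<^sub>j < s\<^sub>j\<close>. Hence \<open>P\<close> takes at some point of \<open>E\<close> a value of
  modulus at least \<open>(\<Prod>j. c\<^sub>j) ^ n\<close> (\<open>exists_large_value\<close>), which bounds all the Chebyshev numbers of
  \<open>E\<close> from below.

  The Chebyshev constant is a limit of \<open>n\<close>-th roots, so a bound on it also needs that the limit
  exists: the Chebyshev numbers are submultiplicative and lie between \<open>0\<close> and \<open>1\<close>, and Fekete's
  argument applies (\<open>submultiplicative_root_convergent\<close>).
\<close>

(* "$" is wanted for the coordinates of complex ^ 'd only. *)
no_notation Matrix.vec_index (infixl \<open>$\<close> 100)

section \<open>Roots of submultiplicative sequences\<close>

text \<open>
  Fekete's lemma in multiplicative form. The limit is the infimum of the roots: writing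
  \<open>n = k * q + r\<close>, the bound \<open>a n \<le> a k ^ q\<close> brings the \<open>n\<close>-th root of \<open>a n\<close> down to the \<open>k\<close>-th root of
  \<open>a k\<close> in the limit, because \<open>q / n\<close> tends to \<open>1 / k\<close>.
\<close>
lemma submultiplicative_root_convergent:
  fixes a :: "nat \<Rightarrow> real"
  assumes nonneg: "\<And>n. 0 \<le> a n" and le_1: "\<And>n. a n \<le> 1"
    and submult: "\<And>m n. a (m + n) \<le> a m * a n"
  shows "convergent (\<lambda>n. root n (a n))"
proof -
  define L where "L = (INF n\<in>{1..}. root n (a n))"
  have bdd: "bdd_below ((\<lambda>n. root n (a n)) ` {1..})"
    using nonneg by (intro bdd_belowI[of _ 0]) auto
  have power_bound: "a (k * q) \<le> a k ^ q" for k q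
  proof (induction q)
    case (Suc q)
    have "a (k * Suc q) \<le> a k * a (k * q)"
      using submult[of k "k * q"] by simp
    also have "\<dots> \<le> a k * a k ^ q"
      using Suc nonneg by (intro mult_left_mono) auto
    finally show ?case by simp
  qed (simp add: le_1)
  have div_bound: "a n \<le> a k ^ (n div k)" for n k
  proof -
    have "a n \<le> a (k * (n div k)) * a (n mod k)"
      using submult[of "k * (n div k)" "n mod k"] by simp
    also have "\<dots> \<le> a (k * (n div k)) * 1"
      using nonneg le_1 by (intro mult_left_mono) auto
    finally show ?thesis using power_bound[of k "n div k"] by simp
  qed
  have upper: "eventually (\<lambda>n. root n (a n) < l) sequentially" if less: "L < l" for l
  proof -
    obtain k where k: "k \<ge> 1" "root k (a k) < l"
      using less cInf_lessD[of "(\<lambda>n. root n (a n)) ` {1..}" l] unfolding L_def by auto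
    show ?thesis
    proof (cases "a k = 0")
      case True
      have "a n = 0" if "n \<ge> k" for n
      proof -
        have "n div k > 0" using that k by (simp add: div_greater_zero_iff)
        then show ?thesis using div_bound[of n k] True nonneg[of n] by (simp add: zero_power)
      qed
      then show ?thesis
        using k True by (auto simp: eventually_sequentially intro!: exI[of _ k])
    next
      case False
      then have pos: "a k > 0" using nonneg[of k] by simp
      have "(\<lambda>n. real (n div k) / real n) \<longlonglongrightarrow> 1 / real k"
      proof (rule tendsto_sandwich)
        show "\<forall>\<^sub>F n in sequentially. 1 / real k - 1 / real n \<le> real (n div k) / real n"
          using eventually_gt_at_top[of 0]
        proof eventually_elim
          case (elim n)
          have "real n = real k * real (n div k) + real (n mod k)"
            by (metis mult_div_mod_eq of_nat_add of_nat_mult)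
          moreover have "real (n mod k) \<le> real k"
            using k by (intro of_nat_mono) (simp add: less_imp_le)
          ultimately have "real n - real k \<le> real k * real (n div k)" by linarith
          then have "(real n - real k) / (real k * real n) \<le> real k * real (n div k) / (real k * real n)"
            by (intro divide_right_mono) auto
          then show ?case using k elim by (simp add: diff_divide_distrib)
        qed
        show "\<forall>\<^sub>F n in sequentially. real (n div k) / real n \<le> 1 / real k"
          using eventually_gt_at_top[of 0]
        proof eventually_elim
          case (elim n)
          have "real k * real (n div k) \<le> real n"
            by (metis of_nat_mono of_nat_mult times_div_less_eq_dividend)
          then show ?case using k elim by (simp add: field_simps)
        qed
        show "(\<lambda>n. 1 / real k - 1 / real n) \<longlonglongrightarrow> 1 / real k"
          using tendsto_diff[OF tendsto_const lim_1_over_n, of "1 / real k"] by simp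
      qed simp
      then have "(\<lambda>n. a k powr (real (n div k) / real n)) \<longlonglongrightarrow> a k powr (1 / real k)"
        using pos by (intro tendsto_powr[OF tendsto_const]) auto
      moreover have "a k powr (1 / real k) < l"
        using k pos by (simp add: root_powr_inverse)
      ultimately have "\<forall>\<^sub>F n in sequentially. a k powr (real (n div k) / real n) < l"
        by (rule order_tendstoD)
      then show ?thesis using eventually_gt_at_top[of 0]
      proof eventually_elim
        case (elim n)
        have "root n (a n) \<le> root n (a k ^ (n div k))"
          using div_bound elim by (intro real_root_le_mono) auto
        also have "\<dots> = a k powr (real (n div k) / real n)"
          using pos elim by (simp add: root_powr_inverse powr_realpow[symmetric] powr_powr)
        finally show ?case using elim by simp
      qed
    qed
  qed
  have lower: "eventually (\<lambda>n. l < root n (a n)) sequentially" if "l < L" for l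
    using eventually_ge_at_top[of 1]
  proof eventually_elim
    case (elim n)
    then have "L \<le> root n (a n)" unfolding L_def using bdd by (intro cINF_lower) auto
    then show ?case using that by simp
  qed
  have "(\<lambda>n. root n (a n)) \<longlonglongrightarrow> L"
    by (rule order_tendstoI) (use upper lower in auto)
  then show ?thesis by (rule convergentI)
qed

section \<open>Minimal polynomials over the integers\<close>

text \<open>
  If \<open>p\<close> did not divide \<open>q\<close> over the rationals, irreducibility would make the two coprime, and
  a Bezout identity evaluated at the common root would read \<open>0 = 1\<close>.
\<close>
lemma degree_le_of_common_root:
  fixes p q :: "int poly" and x :: complex
  assumes irred: "irreducible (map_poly of_int p :: rat poly)"
    and root: "poly (map_poly of_int p) x = 0" "poly (map_poly of_int q) x = 0" and "q \<noteq> 0"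
  shows "degree p \<le> degree q"
proof (rule ccontr)
  interpret rc: inj_idom_hom "of_rat :: rat \<Rightarrow> complex" by unfold_locales (auto simp: of_rat_add of_rat_mult)
  interpret rch: map_poly_inj_idom_hom "of_rat :: rat \<Rightarrow> complex" ..
  assume less: "\<not> degree p \<le> degree q"
  let ?p = "map_poly of_int p :: rat poly" and ?q = "map_poly of_int q :: rat poly"
  have cast: "map_poly of_rat (map_poly of_int r :: rat poly) = (map_poly of_int r :: complex poly)"
    for r :: "int poly"
    by (subst map_poly_map_poly) (auto simp: o_def)
  have "?q \<noteq> 0" using \<open>q \<noteq> 0\<close> by simp
  have "\<not> ?p dvd ?q"
    using dvd_imp_degree_le[OF _ \<open>?q \<noteq> 0\<close>, of ?p] less by auto
  moreover have "prime_elem ?p" using irred by (rule field_poly_irreducible_imp_prime)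
  ultimately have "coprime ?p ?q" by (simp add: prime_elem_imp_coprime)
  then obtain u v where uv: "u * ?p + v * ?q = 1"
    by (metis bezout_coefficients_fst_snd coprime_imp_gcd_eq_1)
  have "poly (map_poly of_rat (u * ?p + v * ?q)) x = 0"
    using root by (simp add: rch.hom_add rch.hom_mult cast)
  then show False by (simp add: uv)
qed

lemma min_poly_degree_minimal:
  assumes "is_min_poly_for p L" "x \<in> L" "q \<noteq> 0" "degree q < degree p"
  shows "poly (map_poly of_int q) x \<noteq> 0"
  using assms degree_le_of_common_root[of p x q]
  by (auto simp: is_min_poly_for_def is_int_min_poly_def)

lemma min_poly_degree_pos:
  assumes "is_min_poly_for p L"
  shows "degree p > 0"
proof (rule ccontr)
  assume "\<not> degree p > 0"
  then obtain c where "p = [:c:]" by (auto elim: degree_eq_zeroE)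
  with assms show False
    by (auto simp: is_min_poly_for_def is_int_min_poly_def map_poly_pCons)
qed

text \<open>
  An irreducible polynomial in characteristic zero is separable: a multiple root would be a root of
  the derivative, which has smaller degree.
\<close>
lemma min_poly_degree_eq_card:
  assumes "is_min_poly_for p L"
  shows "degree p = card L"
proof -
  let ?p = "map_poly of_int p :: complex poly"
  have L: "L = {z. poly ?p z = 0}" using assms by (auto simp: is_min_poly_for_def)
  have pos: "degree p > 0" using assms by (rule min_poly_degree_pos)
  then have [simp]: "?p \<noteq> 0" by auto
  have "pderiv p \<noteq> 0" using pos by (simp add: pderiv_eq_0_iff)
  have pderiv: "pderiv ?p = map_poly of_int (pderiv p)"
    by (rule poly_eqI) (simp add: coeff_pderiv coeff_map_poly)
  have "rsquarefree ?p"
    unfolding rsquarefree_roots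
  proof (intro allI notI)
    fix x assume x: "poly ?p x = 0 \<and> poly (pderiv ?p) x = 0"
    have "degree (pderiv p) < degree p" using pos by (simp add: degree_pderiv)
    then have "poly (map_poly of_int (pderiv p)) x \<noteq> 0"
      using min_poly_degree_minimal[OF assms _ \<open>pderiv p \<noteq> 0\<close>] x L by blast
    then show False using x unfolding pderiv by blast
  qed
  then have "Polynomial.smult (lead_coeff ?p) (\<Prod>z\<in>L. [:- z, 1:]) = ?p"
    unfolding L by (rule complex_poly_decompose_rsquarefree)
  then have "degree ?p = degree (\<Prod>z\<in>L. [:- z, 1:])"
    by (metis \<open>?p \<noteq> 0\<close> degree_smult_eq leading_coeff_0_iff)
  also have "\<dots> = card L" by (subst degree_prod_eq_sum_degree) auto
  finally show ?thesis by simp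
qed

section \<open>The Sylvester determinant\<close>

text \<open>
  The resultant of \<open>p\<close> and \<open>B\<close> as a product over the roots \<open>x c\<close> of \<open>p\<close>. The rows of the matrix are the
  coefficients of the multiples \<open>X ^ r * B\<close> and \<open>X ^ r * p\<close>, with formal degree \<open>n\<close> for \<open>B\<close>. Its
  product with a matrix whose first \<open>m\<close> columns are the powers of the roots and whose other columns
  are unit vectors evaluates the rows at the roots: it has a zero block, as \<open>p\<close> vanishes there, and
  its diagonal blocks are a scaled Vandermonde matrix and a triangular one with diagonal \<open>lead_coeff p\<close>.
  The Vandermonde determinant occurs on both sides and cancels, since the roots are distinct.

  Only the leading coefficient to the power \<open>n\<close> is needed to make the product integral. Passing to the
  algebraic integers \<open>a * x c\<close> would cost the power \<open>n * m\<close>, too much for the final estimate.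
\<close>
lemma det_sylvester:
  fixes p B :: "'a :: field poly" and x :: "nat \<Rightarrow> 'a"
  assumes inj: "inj_on x {..<m}" and deg_p: "degree p = m"
    and roots: "\<And>c. c < m \<Longrightarrow> poly p (x c) = 0" and deg_B: "degree B \<le> n"
  shows "Determinant.det (Matrix.mat (m + n) (m + n)
           (\<lambda>(r, k). coeff (if r < m then monom 1 r * B else monom 1 (r - m) * p) k))
         = lead_coeff p ^ n * (\<Prod>c<m. poly B (x c))"
proof -
  define q where "q = (\<lambda>r. if r < m then monom 1 r * B else monom 1 (r - m) * p)"
  define A where "A = Matrix.mat (m + n) (m + n) (\<lambda>(r, k). coeff (q r) k)"
  \<comment> \<open>The first \<open>m\<close> columns of \<open>V\<close> evaluate the rows of \<open>A\<close> at the roots. The others make \<open>V\<close> square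
    without changing its determinant, which is the Vandermonde determinant.\<close>
  define U where "U = Matrix.mat m m (\<lambda>(c, k). x c ^ k)"
  define V where "V = four_block_mat (transpose_mat U) (0\<^sub>m m n)
                        (Matrix.mat n m (\<lambda>(k, c). x c ^ (m + k))) (1\<^sub>m n)"
  define D where "D = Matrix.mat m m (\<lambda>(r, c). if r = c then poly B (x c) else 0)"
  define T where "T = Matrix.mat n n (\<lambda>(r, c). coeff (q (m + r)) (m + c))"
  have U: "U \<in> carrier_mat m m" and D: "D \<in> carrier_mat m m" and T: "T \<in> carrier_mat n n"
    by (auto simp: U_def D_def T_def)
  have A: "A \<in> carrier_mat (m + n) (m + n)" by (simp add: A_def)
  have V: "V \<in> carrier_mat (m + n) (m + n)" using U by (simp add: V_def)
  have deg_q: "degree (q r) < m + n" if "r < m + n" for r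
  proof (cases "r < m")
    case True
    have "degree (monom 1 r * B) \<le> r + n"
      using degree_mult_le[of "monom 1 r" B] degree_monom_le[of "1::'a" r] deg_B by linarith
    then show ?thesis using True by (simp add: q_def)
  next
    case False
    have "degree (monom 1 (r - m) * p) \<le> (r - m) + m"
      using degree_mult_le[of "monom 1 (r - m)" p] degree_monom_le[of "1::'a" "r - m"] deg_p
      by linarith
    then show ?thesis using False that by (simp add: q_def)
  qed
  have V_left: "V $$ (k, c) = x c ^ k" if "k < m + n" "c < m" for k c
    using that U by (auto simp: V_def U_def)
  have V_right: "V $$ (k, c) = (if k = c then 1 else 0)" if "k < m + n" "m \<le> c" "c < m + n" for k c
    using that U by (auto simp: V_def)
  have AV: "(A * V) $$ (r, c) = (\<Sum>k<m + n. coeff (q r) k * V $$ (k, c))"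
    if "r < m + n" "c < m + n" for r c
    using that A V by (simp add: A_def scalar_prod_def lessThan_atLeast0)
  have AV_left: "(A * V) $$ (r, c) = poly (q r) (x c)" if "r < m + n" "c < m" for r c
  proof -
    have "(A * V) $$ (r, c) = (\<Sum>k<m + n. coeff (q r) k * x c ^ k)"
      using that by (simp add: AV V_left)
    also have "\<dots> = (\<Sum>k\<le>degree (q r). coeff (q r) k * x c ^ k)"
      using deg_q[OF that(1)] by (intro sum.mono_neutral_right) (auto simp: coeff_eq_0)
    finally show ?thesis by (simp add: poly_altdef)
  qed
  have AV_right: "(A * V) $$ (r, c) = coeff (q r) c" if "r < m + n" "m \<le> c" "c < m + n" for r c
    using that by (simp add: AV V_right if_distrib cong: if_cong)
  have "A * V = four_block_mat (transpose_mat U * D)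
                  (Matrix.mat m n (\<lambda>(r, c). coeff (q r) (m + c))) (0\<^sub>m n m) T" (is "_ = ?W")
  proof (rule eq_matI)
    fix r c assume "r < dim_row ?W" "c < dim_col ?W"
    then have rc: "r < m + n" "c < m + n" using U D T by auto
    consider "c \<ge> m" | "c < m" "r \<ge> m" | "c < m" "r < m" by linarith
    then show "(A * V) $$ (r, c) = ?W $$ (r, c)"
    proof cases
      case 1
      then show ?thesis using rc U D T by (simp add: AV_right) (auto simp: T_def)
    next
      case 2
      then show ?thesis using rc U D T roots by (simp add: AV_left q_def)
    next
      case 3
      then have "(transpose_mat U * D) $$ (r, c) = x c ^ r * poly B (x c)"
        by (simp add: U_def D_def scalar_prod_def if_distrib cong: if_cong)
      then show ?thesis using 3 rc U D T
        by (simp add: AV_left q_def poly_monom)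
    qed
  qed (use A V U D T in auto)
  then have "Determinant.det A * Determinant.det V
      = Determinant.det (transpose_mat U * D) * Determinant.det T"
    using det_mult[OF A V] U D T
    by (simp add: det_four_block_mat_lower_left_zero[of _ m _ n])
  moreover have "Determinant.det V = Determinant.det U"
    using U by (simp add: V_def det_four_block_mat_upper_right_zero[of _ m _ n] det_transpose)
  moreover have "Determinant.det (transpose_mat U * D) = Determinant.det U * Determinant.det D"
    using U D by (simp add: det_mult[of _ m] det_transpose)
  moreover have "Determinant.det D = (\<Prod>c<m. poly B (x c))"
    using D by (subst det_lower_triangular[of m])
      (auto simp: D_def prod_list_diag_prod lessThan_atLeast0)
  moreover have "Determinant.det T = lead_coeff p ^ n"
    using T by (subst det_lower_triangular[of n])
      (auto simp: T_def q_def coeff_monom_mult deg_p prod_list_diag_prod coeff_eq_0)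
  moreover have "Determinant.det U \<noteq> 0"
  proof
    assume "Determinant.det U = 0"
    then obtain v where v: "v \<in> carrier_vec m" "v \<noteq> 0\<^sub>v m" "U *\<^sub>v v = 0\<^sub>v m"
      using det_0_iff_vec_prod_zero[OF U] by auto
    \<comment> \<open>The entries of a kernel vector are the coefficients of a polynomial of degree less than \<open>m\<close>
      that vanishes at the \<open>m\<close> points \<open>x c\<close>.\<close>
    define g where "g = (\<Sum>k<m. monom (vec_index v k) k)"
    have coeff_g: "coeff g k = (if k < m then vec_index v k else 0)" for k
      by (simp add: g_def coeff_sum)
    have root_g: "poly g (x c) = 0" if "c < m" for c
    proof -
      have "vec_index (U *\<^sub>v v) c = (\<Sum>k<m. x c ^ k * vec_index v k)"
        using that v(1) by (simp add: U_def scalar_prod_def lessThan_atLeast0)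
      then show ?thesis using v that by (simp add: g_def poly_sum poly_monom mult.commute)
    qed
    have "g \<noteq> 0"
    proof
      assume "g = 0"
      then have "vec_index v k = 0" if "k < m" for k using coeff_g[of k] that by simp
      then show False using v by (auto simp: vec_eq_iff)
    qed
    have "m = card (x ` {..<m})" using inj by (simp add: card_image)
    also have "\<dots> \<le> card {z. poly g z = 0}"
      using \<open>g \<noteq> 0\<close> root_g by (intro card_mono poly_roots_finite) auto
    also have "\<dots> \<le> degree g" using \<open>g \<noteq> 0\<close> by (rule card_poly_roots_bound)
    finally have "m \<le> degree g" .
    then have "coeff g (degree g) = 0" using coeff_g by simp
    then show False using \<open>g \<noteq> 0\<close> by simp
  qed
  ultimately show ?thesis by (simp add: A_def q_def)
qed

section \<open>Functions given by integer polynomials\<close>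

lemma mpoly_eval_superset:
  assumes "finite A" "Poly_Mapping.keys P \<subseteq> A"
  shows "mpoly_eval P z
    = (\<Sum>k\<in>A. of_int (Poly_Mapping.lookup P k) * (\<Prod>i\<in>UNIV. (z $ i) ^ Poly_Mapping.lookup k i))"
  unfolding mpoly_eval_def using assms
  by (intro sum.mono_neutral_left) (auto simp: in_keys_iff)

lemma mpoly_eval_zero [simp]: "mpoly_eval 0 z = 0"
  by (simp add: mpoly_eval_def)

lemma mpoly_eval_add: "mpoly_eval (P + Q) z = mpoly_eval P z + mpoly_eval Q z"
proof -
  let ?A = "Poly_Mapping.keys P \<union> Poly_Mapping.keys Q"
  have "Poly_Mapping.keys (P + Q) \<subseteq> ?A" by (rule Poly_Mapping.keys_add)
  then show ?thesis
    by (simp add: mpoly_eval_superset[of ?A] lookup_add distrib_right sum.distrib)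
qed

lemma mpoly_eval_single:
  "mpoly_eval (Poly_Mapping.single k c) z = of_int c * (\<Prod>i\<in>UNIV. (z $ i) ^ Poly_Mapping.lookup k i)"
  by (subst mpoly_eval_superset[of "{k}"]) auto

text \<open>
  Integer polynomials are handled through the functions that they define: products and determinants
  are then pointwise, and only the bounds on degrees and variables have to be tracked.
\<close>
definition int_poly_funs :: "'d set \<Rightarrow> nat \<Rightarrow> (complex ^ 'd::finite \<Rightarrow> complex) set" where
  "int_poly_funs S n = {mpoly_eval P | P. P \<in> int_polys n \<and> (\<forall>k\<in>Poly_Mapping.keys P. Poly_Mapping.keys k \<subseteq> S)}"

lemma int_poly_funs_zero: "(\<lambda>z. 0) \<in> int_poly_funs S n"
  unfolding int_poly_funs_def by (auto simp: int_polys_def fun_eq_iff intro!: exI[of _ 0])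

lemma int_poly_funs_monomial:
  assumes "exp_degree k \<le> n" "Poly_Mapping.keys k \<subseteq> S"
  shows "(\<lambda>z. of_int c * (\<Prod>i\<in>UNIV. (z $ i) ^ Poly_Mapping.lookup k i)) \<in> int_poly_funs S n"
  unfolding int_poly_funs_def using assms
  by (auto simp: int_polys_def fun_eq_iff mpoly_eval_single intro!: exI[of _ "Poly_Mapping.single k c"]
           split: if_splits)

lemma int_poly_funs_const: "(\<lambda>z. of_int c) \<in> int_poly_funs S n"
  using int_poly_funs_monomial[of 0 n S c] by (simp add: exp_degree_def)

lemma int_poly_funs_add:
  assumes "f \<in> int_poly_funs S n" "g \<in> int_poly_funs S n"
  shows "(\<lambda>z. f z + g z) \<in> int_poly_funs S n"
proof -
  obtain P where P: "f = mpoly_eval P" "P \<in> int_polys n"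
      "\<forall>k\<in>Poly_Mapping.keys P. Poly_Mapping.keys k \<subseteq> S"
    using assms(1) unfolding int_poly_funs_def by auto
  obtain Q where Q: "g = mpoly_eval Q" "Q \<in> int_polys n"
      "\<forall>k\<in>Poly_Mapping.keys Q. Poly_Mapping.keys k \<subseteq> S"
    using assms(2) unfolding int_poly_funs_def by auto
  note PQ = P Q
  have "Poly_Mapping.keys (P + Q) \<subseteq> Poly_Mapping.keys P \<union> Poly_Mapping.keys Q" by (rule Poly_Mapping.keys_add)
  with PQ have "P + Q \<in> int_polys n" "\<forall>k\<in>Poly_Mapping.keys (P + Q). Poly_Mapping.keys k \<subseteq> S"
    by (auto simp: int_polys_def dest!: subsetD[of "Poly_Mapping.keys (P + Q)"])
  moreover have "(\<lambda>z. f z + g z) = mpoly_eval (P + Q)" by (auto simp: PQ mpoly_eval_add)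
  ultimately show ?thesis unfolding int_poly_funs_def by blast
qed

lemma int_poly_funs_sum:
  assumes "\<And>t. t \<in> A \<Longrightarrow> f t \<in> int_poly_funs S n"
  shows "(\<lambda>z. \<Sum>t\<in>A. f t z) \<in> int_poly_funs S n"
  using assms
  by (induction A rule: infinite_finite_induct) (auto intro: int_poly_funs_zero int_poly_funs_add)

lemma int_poly_funs_mult:
  assumes "f \<in> int_poly_funs S m" "g \<in> int_poly_funs S n"
  shows "(\<lambda>z. f z * g z) \<in> int_poly_funs S (m + n)"
proof -
  obtain P where P: "f = mpoly_eval P" "P \<in> int_polys m"
      "\<forall>k\<in>Poly_Mapping.keys P. Poly_Mapping.keys k \<subseteq> S"
    using assms(1) unfolding int_poly_funs_def by auto
  obtain Q where Q: "g = mpoly_eval Q" "Q \<in> int_polys n"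
      "\<forall>k\<in>Poly_Mapping.keys Q. Poly_Mapping.keys k \<subseteq> S"
    using assms(2) unfolding int_poly_funs_def by auto
  note PQ = P Q
  have "(\<lambda>z. f z * g z) = (\<lambda>z. \<Sum>k\<in>Poly_Mapping.keys P. \<Sum>l\<in>Poly_Mapping.keys Q.
      of_int (Poly_Mapping.lookup P k * Poly_Mapping.lookup Q l) *
        (\<Prod>i\<in>UNIV. (z $ i) ^ Poly_Mapping.lookup (k + l) i))"
    by (simp add: PQ mpoly_eval_def sum_product lookup_add power_add prod.distrib mult_ac)
  also have "\<dots> \<in> int_poly_funs S (m + n)"
  proof (intro int_poly_funs_sum int_poly_funs_monomial)
    fix k l assume kl: "k \<in> Poly_Mapping.keys P" "l \<in> Poly_Mapping.keys Q"
    have "exp_degree (k + l) = exp_degree k + exp_degree l"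
      by (simp add: exp_degree_def lookup_add sum.distrib)
    moreover have "exp_degree k \<le> m" "exp_degree l \<le> n" using kl PQ by (auto simp: int_polys_def)
    ultimately show "exp_degree (k + l) \<le> m + n" by simp
    show "Poly_Mapping.keys (k + l) \<subseteq> S" using Poly_Mapping.keys_add[of k l] kl PQ by blast
  qed
  finally show ?thesis .
qed

lemma int_poly_funs_prod:
  assumes "finite A" "\<And>t. t \<in> A \<Longrightarrow> f t \<in> int_poly_funs S (d t)"
  shows "(\<lambda>z. \<Prod>t\<in>A. f t z) \<in> int_poly_funs S (\<Sum>t\<in>A. d t)"
  using assms
proof (induction A)
  case empty
  then show ?case using int_poly_funs_const[of 1 S 0] by simp
qed (auto intro: int_poly_funs_mult)

text \<open>
  In the Leibniz formula each term takes one entry from every row, so the degrees of the rows add up.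
\<close>
lemma int_poly_funs_det:
  assumes "\<And>r c. r < N \<Longrightarrow> c < N \<Longrightarrow> f r c \<in> int_poly_funs S (d r)"
  shows "(\<lambda>z. Determinant.det (Matrix.mat N N (\<lambda>(r, c). f r c z))) \<in> int_poly_funs S (\<Sum>r<N. d r)"
proof -
  have "(\<lambda>z. of_int (sign p) * (\<Prod>r<N. f r (p r) z)) \<in> int_poly_funs S (\<Sum>r<N. d r)"
    if "p permutes {0..<N}" for p
  proof -
    have "p r < N" if "r < N" for r
      using permutes_in_image[OF \<open>p permutes _\<close>, of r] that by simp
    then have "(\<lambda>z. \<Prod>r<N. f r (p r) z) \<in> int_poly_funs S (\<Sum>r<N. d r)"
      by (intro int_poly_funs_prod assms) auto
    then show ?thesis using int_poly_funs_mult[OF int_poly_funs_const[of "sign p" S 0]] by simp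
  qed
  then have "(\<lambda>z. \<Sum>p | p permutes {0..<N}. of_int (sign p) * (\<Prod>r<N. f r (p r) z))
      \<in> int_poly_funs S (\<Sum>r<N. d r)"
    by (intro int_poly_funs_sum) auto
  also have "(\<lambda>z. \<Sum>p | p permutes {0..<N}. of_int (sign p) * (\<Prod>r<N. f r (p r) z))
      = (\<lambda>z. Determinant.det (Matrix.mat N N (\<lambda>(r, c). f r c z)))"
  proof
    fix z
    have "(\<Prod>r<N. f r (p r) z) = (\<Prod>i = 0..<N. Matrix.mat N N (\<lambda>(r, c). f r c z) $$ (i, p i))"
      if "p permutes {0..<N}" for p
    proof -
      have "p r < N" if "r < N" for r
        using permutes_in_image[OF \<open>p permutes _\<close>, of r] that by simp
      then show ?thesis by (auto simp: lessThan_atLeast0 intro!: prod.cong)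
    qed
    then show "(\<Sum>p | p permutes {0..<N}. of_int (sign p) * (\<Prod>r<N. f r (p r) z))
        = Determinant.det (Matrix.mat N N (\<lambda>(r, c). f r c z))"
      by (subst det_def'[of _ N]) auto
  qed
  finally show ?thesis .
qed

section \<open>Integer polynomials as polynomials in one variable\<close>

definition replace_coord :: "complex ^ 'd::finite \<Rightarrow> 'd \<Rightarrow> complex \<Rightarrow> complex ^ 'd" where
  "replace_coord z i x = (\<chi> j. if j = i then x else z $ j)"

lemma replace_coord_nth: "replace_coord z i x $ j = (if j = i then x else z $ j)"
  by (simp add: replace_coord_def)

lemma monomial_replace_coord:
  "(\<Prod>j\<in>UNIV. (replace_coord z i x $ j) ^ Poly_Mapping.lookup k j)
   = x ^ Poly_Mapping.lookup k i * (\<Prod>j\<in>UNIV - {i}. (z $ j) ^ Poly_Mapping.lookup k j)"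
proof -
  have "(\<Prod>j\<in>UNIV - {i}. (replace_coord z i x $ j) ^ Poly_Mapping.lookup k j)
      = (\<Prod>j\<in>UNIV - {i}. (z $ j) ^ Poly_Mapping.lookup k j)"
    by (intro prod.cong) (auto simp: replace_coord_nth)
  then show ?thesis by (subst prod.remove[of UNIV i]) (auto simp: replace_coord_nth)
qed

lemma lookup_le_exp_degree: "Poly_Mapping.lookup k i \<le> exp_degree k"
  unfolding exp_degree_def by (rule member_le_sum) auto

text \<open>
  The restriction of \<open>P\<close> to the line through \<open>z\<close> in the direction of the \<open>i\<close>-th coordinate, as a
  polynomial in that coordinate.
\<close>
definition fibre_poly :: "('d::finite) int_mpoly \<Rightarrow> 'd \<Rightarrow> complex ^ 'd \<Rightarrow> complex poly" where
  "fibre_poly P i z = (\<Sum>k\<in>Poly_Mapping.keys P.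
     monom (of_int (Poly_Mapping.lookup P k) * (\<Prod>j\<in>UNIV - {i}. (z $ j) ^ Poly_Mapping.lookup k j))
       (Poly_Mapping.lookup k i))"

lemma poly_fibre_poly: "poly (fibre_poly P i z) x = mpoly_eval P (replace_coord z i x)"
  by (simp add: fibre_poly_def mpoly_eval_def poly_sum poly_monom monomial_replace_coord mult_ac)

lemma degree_fibre_poly:
  assumes "P \<in> int_polys n"
  shows "degree (fibre_poly P i z) \<le> n"
  unfolding fibre_poly_def
proof (intro degree_sum_le)
  fix k assume "k \<in> Poly_Mapping.keys P"
  then have "Poly_Mapping.lookup k i \<le> n"
    using assms lookup_le_exp_degree[of k i] by (auto simp: int_polys_def)
  then show "degree (monom (of_int (Poly_Mapping.lookup P k) *
      (\<Prod>j\<in>UNIV - {i}. (z $ j) ^ Poly_Mapping.lookup k j)) (Poly_Mapping.lookup k i)) \<le> n"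
    by (rule order_trans[OF degree_monom_le])
qed simp

text \<open>
  As functions of \<open>z\<close>, the coefficients are again integer polynomials, now free of the \<open>i\<close>-th variable.
\<close>
lemma coeff_fibre_poly:
  assumes P: "P \<in> int_polys n" "\<And>k. k \<in> Poly_Mapping.keys P \<Longrightarrow> Poly_Mapping.keys k \<subseteq> insert i S"
  shows "(\<lambda>z. coeff (fibre_poly P i z) l) \<in> int_poly_funs S n"
proof -
  have monomial: "(\<lambda>z. of_int c * (\<Prod>j\<in>UNIV - {i}. (z $ j) ^ Poly_Mapping.lookup k j)) \<in> int_poly_funs S n"
    if k: "k \<in> Poly_Mapping.keys P" for k c
  proof -
    \<comment> \<open>The monomial without its \<open>i\<close>-th variable.\<close>
    define k' where "k' = Poly_Mapping.update i 0 k"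
    have lookup: "Poly_Mapping.lookup k' j = (if j = i then 0 else Poly_Mapping.lookup k j)" for j
      by (simp add: k'_def lookup_update)
    have "(\<Prod>j\<in>UNIV - {i}. (z $ j) ^ Poly_Mapping.lookup k j)
        = (\<Prod>j\<in>UNIV. (z $ j) ^ Poly_Mapping.lookup k' j)" for z :: "complex ^ 'a"
      by (rule prod.mono_neutral_cong_left) (auto simp: lookup)
    moreover have "exp_degree k' \<le> exp_degree k"
      unfolding exp_degree_def by (intro sum_mono) (simp add: lookup)
    then have "exp_degree k' \<le> n"
      using P(1) k unfolding int_polys_def by (blast intro: order_trans)
    moreover have "Poly_Mapping.keys k' \<subseteq> S"
    proof
      fix j assume "j \<in> Poly_Mapping.keys k'"
      then have "j \<in> Poly_Mapping.keys k" "j \<noteq> i" by (auto simp: in_keys_iff lookup split: if_splits)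
      then show "j \<in> S" using P(2)[OF k] by blast
    qed
    ultimately show ?thesis by (simp add: int_poly_funs_monomial)
  qed
  have "(\<lambda>z. \<Sum>k\<in>Poly_Mapping.keys P. if Poly_Mapping.lookup k i = l
      then of_int (Poly_Mapping.lookup P k) * (\<Prod>j\<in>UNIV - {i}. (z $ j) ^ Poly_Mapping.lookup k j)
      else 0) \<in> int_poly_funs S n"
  proof (rule int_poly_funs_sum)
    fix k assume "k \<in> Poly_Mapping.keys P"
    from monomial[OF this, of "Poly_Mapping.lookup P k"]
    show "(\<lambda>z. if Poly_Mapping.lookup k i = l
      then of_int (Poly_Mapping.lookup P k) * (\<Prod>j\<in>UNIV - {i}. (z $ j) ^ Poly_Mapping.lookup k j)
      else 0) \<in> int_poly_funs S n"
      by (cases "Poly_Mapping.lookup k i = l") (simp_all add: int_poly_funs_zero)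
  qed
  then show ?thesis by (simp add: fibre_poly_def coeff_sum)
qed

section \<open>Kronecker substitution\<close>

text \<open>
  The weights are the powers of \<open>n + 1\<close>: the weighted sum is the number with digits \<open>k j\<close> in base
  \<open>n + 1\<close>, which determines its digits.
\<close>
lemma kronecker_weights:
  assumes "finite A"
  shows "\<exists>e :: 'd \<Rightarrow> nat. \<forall>k k'. (\<forall>j\<in>A. k j \<le> n \<and> k' j \<le> n) \<longrightarrow>
           (\<Sum>j\<in>A. e j * k j) = (\<Sum>j\<in>A. e j * k' j) \<longrightarrow> (\<forall>j\<in>A. k j = k' j)"
  using assms
proof (induction A)
  case (insert x A)
  from insert.IH obtain e :: "'d \<Rightarrow> nat" where
    e: "\<forall>k k'. (\<forall>j\<in>A. k j \<le> n \<and> k' j \<le> n) \<longrightarrow>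
      (\<Sum>j\<in>A. e j * k j) = (\<Sum>j\<in>A. e j * k' j) \<longrightarrow> (\<forall>j\<in>A. k j = k' j)" ..
  define e' where "e' = (\<lambda>j. if j = x then 1 else Suc n * e j)"
  have sum_e': "(\<Sum>j\<in>insert x A. e' j * k j) = k x + Suc n * (\<Sum>j\<in>A. e j * k j)" for k
  proof -
    have "(\<Sum>j\<in>A. e' j * k j) = (\<Sum>j\<in>A. Suc n * (e j * k j))"
    proof (rule sum.cong)
      fix j assume "j \<in> A"
      then have "j \<noteq> x" using insert.hyps by blast
      then show "e' j * k j = Suc n * (e j * k j)" by (simp only: e'_def if_False mult.assoc)
    qed simp
    also have "\<dots> = Suc n * (\<Sum>j\<in>A. e j * k j)" by (rule sum_distrib_left[symmetric])
    finally show ?thesis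
      using insert.hyps by (simp add: e'_def del: mult_Suc)
  qed
  have *: "\<forall>j\<in>insert x A. k j = k' j"
    if bound: "\<forall>j\<in>insert x A. k j \<le> n \<and> k' j \<le> n"
      and eq: "(\<Sum>j\<in>insert x A. e' j * k j) = (\<Sum>j\<in>insert x A. e' j * k' j)" for k k'
  proof -
    let ?s = "\<Sum>j\<in>A. e j * k j" and ?s' = "\<Sum>j\<in>A. e j * k' j"
    have eq': "k x + Suc n * ?s = k' x + Suc n * ?s'" using eq unfolding sum_e' .
    have "k x < Suc n" "k' x < Suc n" using bound by (auto simp: less_Suc_eq_le)
    then have "(k x + Suc n * ?s) mod Suc n = k x" "(k' x + Suc n * ?s') mod Suc n = k' x"
      by (simp_all only: mod_mult_self2 mod_less)
    then have digit: "k x = k' x" unfolding eq' by (rule trans[OF sym])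
    with eq' have "Suc n * ?s = Suc n * ?s'" by linarith
    then have "?s = ?s'" by (simp only: mult_cancel1) simp
    moreover have "\<forall>j\<in>A. k j \<le> n \<and> k' j \<le> n" using bound by blast
    ultimately have "\<forall>j\<in>A. k j = k' j" using e[rule_format, of k k'] by blast
    with digit show ?thesis by blast
  qed
  show ?case by (rule exI[of _ e'], intro allI impI, rule *)
qed simp

text \<open>
  Substituting \<open>z\<^sub>j = t ^ e j\<close> for \<open>j \<noteq> i\<close> keeps apart the monomials of \<open>P\<close> that differ outside the
  \<open>i\<close>-th variable. With \<open>z\<^sub>i = x\<close>, the coefficients of the resulting polynomial in \<open>t\<close> are values
  at \<open>x\<close> of integer polynomials in one variable of degree at most \<open>n\<close>, one of which, \<open>b\<close>, is nonzero.
  The weights \<open>e\<close> depend on the degree only, so finitely many polynomials, or finitely many values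
  of \<open>x\<close>, can be treated on one curve; there a common non-root exists because complex
  polynomials in one variable form an integral domain.
\<close>
lemma kronecker_substitution:
  fixes i :: "'d::finite"
  obtains e :: "'d \<Rightarrow> nat" where
    "\<forall>P\<in>int_polys n - {0}. \<exists>b :: int poly. b \<noteq> 0 \<and> degree b \<le> n \<and>
    (\<forall>x. poly (map_poly of_int b) x \<noteq> 0 \<longrightarrow>
      (\<exists>q. q \<noteq> 0 \<and> (\<forall>t. poly q t = mpoly_eval P (replace_coord (\<chi> j. t ^ e j) i x))))"
proof -
  obtain e :: "'d \<Rightarrow> nat" where e: "\<And>k k'. (\<forall>j\<in>UNIV - {i}. k j \<le> n \<and> k' j \<le> n) \<Longrightarrow>
      (\<Sum>j\<in>UNIV - {i}. e j * k j) = (\<Sum>j\<in>UNIV - {i}. e j * k' j) \<Longrightarrow> (\<forall>j\<in>UNIV - {i}. k j = k' j)"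
    using kronecker_weights[of "UNIV - {i}" n] by auto
  have *: "\<exists>b :: int poly. b \<noteq> 0 \<and> degree b \<le> n \<and>
    (\<forall>x. poly (map_poly of_int b) x \<noteq> 0 \<longrightarrow>
      (\<exists>q. q \<noteq> 0 \<and> (\<forall>t. poly q t = mpoly_eval P (replace_coord (\<chi> j. t ^ e j) i x))))"
    if "P \<in> int_polys n - {0}" for P
  proof -
    from that have P: "P \<in> int_polys n" "P \<noteq> 0" by auto
    define w where "w = (\<lambda>k :: 'd \<Rightarrow>\<^sub>0 nat. \<Sum>j\<in>UNIV - {i}. e j * Poly_Mapping.lookup k j)"
    have bound: "Poly_Mapping.lookup k j \<le> n" if "k \<in> Poly_Mapping.keys P" for k j
      using that P lookup_le_exp_degree[of k j] by (auto simp: int_polys_def)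
    have w_inj: "Poly_Mapping.lookup k j = Poly_Mapping.lookup k' j"
      if "k \<in> Poly_Mapping.keys P" "k' \<in> Poly_Mapping.keys P" "w k = w k'" "j \<noteq> i" for k k' j
      using e[of "Poly_Mapping.lookup k" "Poly_Mapping.lookup k'"] that bound by (auto simp: w_def)
    obtain k0 where k0: "k0 \<in> Poly_Mapping.keys P" using P by (metis keys_eq_empty ex_in_conv)
    \<comment> \<open>The exponents that agree with \<open>k0\<close> outside \<open>i\<close>; they are told apart by their entry at \<open>i\<close>, so no
      coefficients of \<open>P\<close> are added up in \<open>b\<close>.\<close>
    define K where "K = {k \<in> Poly_Mapping.keys P. w k = w k0}"
    define b where "b = (\<Sum>k\<in>K. monom (Poly_Mapping.lookup P k) (Poly_Mapping.lookup k i))"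
    have "finite K" by (simp add: K_def)
    have "coeff b (Poly_Mapping.lookup k0 i) = (\<Sum>k\<in>K. if k = k0 then Poly_Mapping.lookup P k else 0)"
      unfolding b_def coeff_sum
    proof (rule sum.cong)
      fix k assume "k \<in> K"
      then have "Poly_Mapping.lookup k i = Poly_Mapping.lookup k0 i \<longleftrightarrow> k = k0"
        using w_inj[of k k0] k0 unfolding K_def mem_Collect_eq by (metis poly_mapping_eqI)
      then show "coeff (monom (Poly_Mapping.lookup P k) (Poly_Mapping.lookup k i)) (Poly_Mapping.lookup k0 i)
          = (if k = k0 then Poly_Mapping.lookup P k else 0)"
        by simp
    qed simp
    also have "\<dots> \<noteq> 0" using k0 \<open>finite K\<close> by (simp add: K_def in_keys_iff)
    finally have "b \<noteq> 0" by auto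
    moreover have "degree b \<le> n"
      unfolding b_def
    proof (intro degree_sum_le)
      show "degree (monom (Poly_Mapping.lookup P k) (Poly_Mapping.lookup k i)) \<le> n" if "k \<in> K" for k
        using that bound[of k i] degree_monom_le[of "Poly_Mapping.lookup P k" "Poly_Mapping.lookup k i"]
        by (auto simp: K_def)
    qed (use \<open>finite K\<close> in auto)
    moreover have "\<exists>q. q \<noteq> 0 \<and> (\<forall>t. poly q t = mpoly_eval P (replace_coord (\<chi> j. t ^ e j) i x))"
      if x: "poly (map_poly of_int b) x \<noteq> 0" for x
    proof -
      define q where "q = (\<Sum>k\<in>Poly_Mapping.keys P.
        monom (of_int (Poly_Mapping.lookup P k) * x ^ Poly_Mapping.lookup k i) (w k))"
      have map_b: "map_poly of_int b
          = (\<Sum>k\<in>K. monom (of_int (Poly_Mapping.lookup P k)) (Poly_Mapping.lookup k i) :: complex poly)"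
        by (rule poly_eqI) (simp add: b_def coeff_map_poly coeff_sum if_distrib cong: if_cong)
      have "coeff q (w k0) = (\<Sum>k\<in>K. of_int (Poly_Mapping.lookup P k) * x ^ Poly_Mapping.lookup k i)"
        unfolding q_def K_def by (simp add: coeff_sum sum.inter_filter)
      also have "\<dots> = poly (map_poly of_int b) x" by (simp add: map_b poly_sum poly_monom)
      finally have "q \<noteq> 0" using x by auto
      moreover have "poly q t = mpoly_eval P (replace_coord (\<chi> j. t ^ e j) i x)" for t
        unfolding mpoly_eval_def monomial_replace_coord
        by (simp add: q_def w_def poly_sum poly_monom power_sum power_mult mult_ac)
      ultimately show ?thesis by (intro exI[of _ q] conjI allI)
    qed
    ultimately show ?thesis by (intro exI[of _ b] conjI allI impI)
  qed
  show ?thesis by (rule that, rule ballI, rule *)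
qed

lemma exists_common_nonroot:
  fixes q :: "'i \<Rightarrow> complex poly"
  assumes "finite A" "\<And>t. t \<in> A \<Longrightarrow> q t \<noteq> 0"
  shows "\<exists>x. \<forall>t\<in>A. poly (q t) x \<noteq> 0"
proof -
  have "(\<Prod>t\<in>A. q t) \<noteq> 0" using assms by simp
  then obtain x where "poly (\<Prod>t\<in>A. q t) x \<noteq> 0" using poly_all_0_iff_0 by blast
  then show ?thesis using assms by (auto simp: poly_prod)
qed

text \<open>
  The ring of polynomials is an integral domain; Kronecker substitution gives a point where neither
  factor vanishes. This is what makes the Chebyshev numbers submultiplicative.
\<close>
lemma int_poly_prod_nonzero:
  assumes "P \<in> int_polys m" "P \<noteq> 0" "Q \<in> int_polys n" "Q \<noteq> 0"
  shows "\<exists>R\<in>int_polys (m + n) - {0}. \<forall>z. mpoly_eval R z = mpoly_eval P z * mpoly_eval Q z"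
proof -
  \<comment> \<open>No variable is distinguished here; the substitution treats an arbitrary one apart.\<close>
  fix i :: 'a
  have mono: "P \<in> int_polys (m + n)" "Q \<in> int_polys (m + n)"
    using assms by (force simp: int_polys_def)+
  obtain e :: "'a \<Rightarrow> nat" where e: "\<forall>P\<in>int_polys (m + n) - {0}. \<exists>b :: int poly. b \<noteq> 0 \<and> degree b \<le> m + n \<and>
    (\<forall>x. poly (map_poly of_int b) x \<noteq> 0 \<longrightarrow>
      (\<exists>q. q \<noteq> 0 \<and> (\<forall>t. poly q t = mpoly_eval P (replace_coord (\<chi> j. t ^ e j) i x))))"
    by (rule kronecker_substitution[of "m + n" i], rule that)
  obtain b where b: "b \<noteq> 0" "\<And>x. poly (map_poly of_int b) x \<noteq> 0 \<Longrightarrow>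
      \<exists>q. q \<noteq> 0 \<and> (\<forall>t. poly q t = mpoly_eval P (replace_coord (\<chi> j. t ^ e j) i x))"
    using e[rule_format, of P] mono(1) assms(2) by blast
  obtain c where c: "c \<noteq> 0" "\<And>x. poly (map_poly of_int c) x \<noteq> 0 \<Longrightarrow>
      \<exists>q. q \<noteq> 0 \<and> (\<forall>t. poly q t = mpoly_eval Q (replace_coord (\<chi> j. t ^ e j) i x))"
    using e[rule_format, of Q] mono(2) assms(4) by blast
  obtain x :: complex where "\<forall>p\<in>{b, c}. poly (map_poly of_int p) x \<noteq> 0"
    using exists_common_nonroot[of "{b, c}" "map_poly of_int"] b c by auto
  then have x: "poly (map_poly of_int b) x \<noteq> 0" "poly (map_poly of_int c) x \<noteq> 0" by simp_all
  obtain q where q: "q \<noteq> 0" "\<And>t. poly q t = mpoly_eval P (replace_coord (\<chi> j. t ^ e j) i x)"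
    using b(2)[OF x(1)] by blast
  obtain r where r: "r \<noteq> 0" "\<And>t. poly r t = mpoly_eval Q (replace_coord (\<chi> j. t ^ e j) i x)"
    using c(2)[OF x(2)] by blast
  obtain t where t: "\<forall>p\<in>{q, r}. poly p t \<noteq> 0"
    using exists_common_nonroot[of "{q, r}" id] q r by auto
  have "(\<lambda>z. mpoly_eval P z * mpoly_eval Q z) \<in> int_poly_funs UNIV (m + n)"
    using assms by (intro int_poly_funs_mult) (auto simp: int_poly_funs_def)
  then obtain R where R: "R \<in> int_polys (m + n)"
      "(\<lambda>z. mpoly_eval P z * mpoly_eval Q z) = mpoly_eval R"
    by (auto simp: int_poly_funs_def)
  have eval_R: "mpoly_eval R z = mpoly_eval P z * mpoly_eval Q z" for z
    using fun_cong[OF R(2), of z] by simp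
  from t have "mpoly_eval R (replace_coord (\<chi> j. t ^ e j) i x) \<noteq> 0"
    unfolding eval_R q(2)[symmetric] r(2)[symmetric] by simp
  then have "R \<noteq> 0" by auto
  with R(1) eval_R show ?thesis by (intro bexI[of _ R]) simp_all
qed

section \<open>Elimination of one variable\<close>

text \<open>
  \<open>Q\<close> is the resultant of \<open>p\<close> and \<open>P\<close> in the \<open>i\<close>-th variable. As a determinant it has integer
  coefficients; only the \<open>card L\<close> rows that hold coefficients of \<open>P\<close> contribute to its degree. The
  condition \<open>n < card L\<close> makes it nonzero, because the polynomial \<open>b\<close> of \<open>kronecker_substitution\<close>,
  of degree at most \<open>n\<close>, does not vanish at the elements of \<open>L\<close>.
\<close>
lemma partial_norm:
  fixes i :: "'d::finite"
  assumes P: "P \<in> int_polys n" "P \<noteq> 0" "\<And>k. k \<in> Poly_Mapping.keys P \<Longrightarrow> Poly_Mapping.keys k \<subseteq> insert i S"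
    and p: "is_min_poly_for p L" and large: "n < card L"
  shows "\<exists>Q\<in>int_polys (n * card L) - {0}. (\<forall>k\<in>Poly_Mapping.keys Q. Poly_Mapping.keys k \<subseteq> S) \<and>
    (\<forall>z. mpoly_eval Q z = of_int (lead_coeff p) ^ n * (\<Prod>x\<in>L. mpoly_eval P (replace_coord z i x)))"
proof -
  define m where "m = card L"
  let ?p = "map_poly of_int p :: complex poly"
  have "finite L" using large card.infinite by fastforce
  then obtain x where x: "bij_betw x {..<m} L"
    using ex_bij_betw_nat_finite[of L] by (auto simp: m_def lessThan_atLeast0)
  have L: "L = {z. poly ?p z = 0}" using p by (auto simp: is_min_poly_for_def)
  have deg_p: "degree p = m" using min_poly_degree_eq_card[OF p] by (simp add: m_def)
  define A where "A = (\<lambda>r k z. coeff (if r < m then monom 1 r * fibre_poly P i z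
                                      else monom 1 (r - m) * ?p) k)"
  define F where "F = (\<lambda>z. Determinant.det (Matrix.mat (m + n) (m + n) (\<lambda>(r, k). A r k z)))"
  have F_eq: "F z = of_int (lead_coeff p) ^ n * (\<Prod>y\<in>L. mpoly_eval P (replace_coord z i y))" for z
  proof -
    have "F z = lead_coeff ?p ^ n * (\<Prod>c<m. poly (fibre_poly P i z) (x c))"
      unfolding F_def A_def
    proof (rule det_sylvester)
      show "inj_on x {..<m}" using x by (rule bij_betw_imp_inj_on)
      show "poly ?p (x c) = 0" if "c < m" for c
        using bij_betwE[OF x] that L by auto
    qed (use P deg_p in \<open>auto intro: degree_fibre_poly\<close>)
    also have "(\<Prod>c<m. poly (fibre_poly P i z) (x c)) = (\<Prod>y\<in>L. poly (fibre_poly P i z) y)"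
      using x by (rule prod.reindex_bij_betw)
    finally show ?thesis by (simp add: poly_fibre_poly)
  qed
  have "F \<in> int_poly_funs S (\<Sum>r<m + n. if r < m then n else 0)"
    unfolding F_def
  proof (rule int_poly_funs_det)
    fix r k
    show "A r k \<in> int_poly_funs S (if r < m then n else 0)"
    proof (cases "r < m")
      case True
      then have "A r k = (\<lambda>z. if k < r then 0 else coeff (fibre_poly P i z) (k - r))"
        by (simp add: A_def coeff_monom_mult fun_eq_iff)
      then show ?thesis using True coeff_fibre_poly[OF P(1,3)] int_poly_funs_zero by (cases "k < r") auto
    next
      case False
      then have "A r k = (\<lambda>z. of_int (coeff (monom 1 (r - m) * p) k))"
        by (simp add: A_def coeff_monom_mult fun_eq_iff)
      then show ?thesis using False by (simp add: int_poly_funs_const del: of_int_0)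
    qed
  qed
  also have "(\<Sum>r<m + n. if r < m then n else 0) = (\<Sum>r<m. n)"
    by (rule sum.mono_neutral_cong_right) auto
  finally have "F \<in> int_poly_funs S (n * m)" by (simp add: mult.commute)
  then obtain Q where Q: "Q \<in> int_polys (n * m)" "F = mpoly_eval Q"
      "\<forall>k\<in>Poly_Mapping.keys Q. Poly_Mapping.keys k \<subseteq> S"
    by (auto simp: int_poly_funs_def)
  have "Q \<noteq> 0"
  proof -
    obtain e :: "'d \<Rightarrow> nat" where e: "\<forall>P\<in>int_polys n - {0}. \<exists>b :: int poly. b \<noteq> 0 \<and> degree b \<le> n \<and>
        (\<forall>x. poly (map_poly of_int b) x \<noteq> 0 \<longrightarrow>
          (\<exists>q. q \<noteq> 0 \<and> (\<forall>t. poly q t = mpoly_eval P (replace_coord (\<chi> j. t ^ e j) i x))))"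
      by (rule kronecker_substitution[of n i], rule that)
    obtain b where b: "b \<noteq> 0" "degree b \<le> n" and q: "\<And>y. poly (map_poly of_int b) y \<noteq> 0 \<Longrightarrow>
        \<exists>q. q \<noteq> 0 \<and> (\<forall>t. poly q t = mpoly_eval P (replace_coord (\<chi> j. t ^ e j) i y))"
      using e[rule_format, of P] P(1,2) by blast
    have "poly (map_poly of_int b) y \<noteq> 0" if "y \<in> L" for y
      using min_poly_degree_minimal[OF p that b(1)] b(2) deg_p large by (simp add: m_def)
    with q obtain q where q: "\<And>y. y \<in> L \<Longrightarrow> q y \<noteq> 0"
        "\<And>y t. y \<in> L \<Longrightarrow> poly (q y) t = mpoly_eval P (replace_coord (\<chi> j. t ^ e j) i y)"
      by metis
    obtain t where "\<forall>y\<in>L. poly (q y) t \<noteq> 0"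
      using exists_common_nonroot[OF \<open>finite L\<close>, of q] q by auto
    then have "(\<Prod>y\<in>L. mpoly_eval P (replace_coord (\<chi> j. t ^ e j) i y)) \<noteq> 0"
      using q \<open>finite L\<close> by simp
    moreover have "lead_coeff p \<noteq> 0" using min_poly_degree_pos[OF p] by auto
    ultimately have "F (\<chi> j. t ^ e j) \<noteq> 0" by (simp add: F_eq)
    then show ?thesis using Q by auto
  qed
  moreover have "mpoly_eval Q z = of_int (lead_coeff p) ^ n * (\<Prod>y\<in>L. mpoly_eval P (replace_coord z i y))" for z
    using F_eq[of z] unfolding Q(2) .
  ultimately show ?thesis using Q(1,3) unfolding m_def by (intro bexI[of _ Q]) simp_all
qed

text \<open>
  The variables in \<open>S\<close> are eliminated one at a time. The size \<open>l\<close> of the conjugate set for the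
  variable at hand has to exceed the degree of the current polynomial, which depends on the sizes
  chosen before; hence the assumption that suitable sizes are unbounded. Its inequality says
  \<open>c j \<le> \<bar>a j m\<bar> powr (- 1 / m)\<close>, free of roots.
\<close>
lemma exists_large_value:
  fixes P :: "'d::finite int_mpoly" and c :: "'d \<Rightarrow> real"
  assumes "finite S" "P \<in> int_polys n" "P \<noteq> 0" "\<And>k. k \<in> Poly_Mapping.keys P \<Longrightarrow> Poly_Mapping.keys k \<subseteq> S"
    and c: "\<And>j. 0 \<le> c j"
    and L: "\<And>j m. m \<in> M j \<Longrightarrow> card (L j m) = m"
      "\<And>j m. m \<in> M j \<Longrightarrow> \<exists>p. is_min_poly_for p (L j m) \<and> a j m = lead_coeff p"
    and M: "\<And>j N. \<exists>m\<in>M j. N < m \<and> c j ^ m * real_of_int \<bar>a j m\<bar> \<le> 1"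
  shows "\<exists>m z. (\<forall>j\<in>S. m j \<in> M j \<and> z $ j \<in> L j (m j)) \<and> (\<Prod>j\<in>S. c j) ^ n \<le> norm (mpoly_eval P z)"
  using assms(1-4)
proof (induction S arbitrary: P n rule: finite_induct)
  case empty
  have keys: "Poly_Mapping.keys P = {0}"
    using empty by (metis keys_eq_empty subset_empty subset_singletonD subsetI singletonI)
  then have "mpoly_eval P z = of_int (Poly_Mapping.lookup P 0)" for z
    by (simp add: mpoly_eval_def)
  moreover have "Poly_Mapping.lookup P 0 \<noteq> 0" using keys by (simp flip: in_keys_iff)
  ultimately show ?case by (auto simp: norm_of_int simp flip: of_int_abs)
next
  case (insert i S)
  obtain l where l: "l \<in> M i" "n < l" "c i ^ l * real_of_int \<bar>a i l\<bar> \<le> 1" using M by blast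
  obtain p where p: "is_min_poly_for p (L i l)" "a i l = lead_coeff p" using L l by blast
  have card: "card (L i l) = l" using L l by blast
  have "finite (L i l)" "L i l \<noteq> {}" using card l by (auto intro: card_ge_0_finite)
  obtain Q where Q: "Q \<in> int_polys (n * l)" "Q \<noteq> 0"
      "\<And>k. k \<in> Poly_Mapping.keys Q \<Longrightarrow> Poly_Mapping.keys k \<subseteq> S"
      "\<And>z. mpoly_eval Q z = of_int (lead_coeff p) ^ n * (\<Prod>x\<in>L i l. mpoly_eval P (replace_coord z i x))"
    using partial_norm[OF insert.prems p(1)] l card by auto
  obtain m z where mz: "\<forall>j\<in>S. m j \<in> M j \<and> z $ j \<in> L j (m j)"
      "(\<Prod>j\<in>S. c j) ^ (n * l) \<le> norm (mpoly_eval Q z)"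
    using insert.IH[OF Q(1-3)] by blast
  define C where "C = (\<Prod>j\<in>S. c j)"
  have "C \<ge> 0" using c by (auto simp: C_def intro: prod_nonneg)
  \<comment> \<open>Otherwise the product over the \<open>l\<close> conjugates would be too small for the bound on \<open>Q\<close>.\<close>
  have "\<exists>x\<in>L i l. (c i * C) ^ n \<le> norm (mpoly_eval P (replace_coord z i x))"
  proof (rule ccontr)
    assume "\<not> ?thesis"
    then have small: "norm (mpoly_eval P (replace_coord z i x)) < (c i * C) ^ n" if "x \<in> L i l" for x
      using that by auto
    let ?A = "real_of_int \<bar>a i l\<bar>"
    have "?A > 0" using min_poly_degree_pos[OF p(1)] p(2) by auto
    obtain x0 where "x0 \<in> L i l" using \<open>L i l \<noteq> {}\<close> by blast
    have "C ^ (n * l) \<le> ?A ^ n * (\<Prod>x\<in>L i l. norm (mpoly_eval P (replace_coord z i x)))"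
      using mz(2) Q(4)[of z] p(2) by (simp add: C_def norm_mult norm_power prod_norm)
    also have "\<dots> < ?A ^ n * (\<Prod>x\<in>L i l. (c i * C) ^ n)"
      using small \<open>finite (L i l)\<close> \<open>?A > 0\<close>
      by (intro mult_strict_left_mono prod_mono_strict[OF \<open>x0 \<in> L i l\<close>])
        (auto intro: less_imp_le le_less_trans[OF norm_ge_zero] simp: \<open>x0 \<in> L i l\<close>)
    also have "\<dots> = (c i ^ l * ?A) ^ n * C ^ (n * l)"
      by (simp add: card power_mult_distrib mult_ac flip: power_mult)
    also have "\<dots> \<le> 1 * C ^ (n * l)"
      using l c[of i] \<open>C \<ge> 0\<close> by (intro mult_right_mono power_le_one) auto
    finally show False by simp
  qed
  then obtain x where x: "x \<in> L i l" "(c i * C) ^ n \<le> norm (mpoly_eval P (replace_coord z i x))" by blast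
  moreover have "(\<Prod>j\<in>insert i S. c j) = c i * C" using insert.hyps by (simp add: C_def)
  moreover have "\<forall>j\<in>insert i S. (m(i := l)) j \<in> M j \<and> replace_coord z i x $ j \<in> L j ((m(i := l)) j)"
    using mz(1) x l insert.hyps by (auto simp: replace_coord_nth)
  ultimately show ?case by (intro exI[of _ "m(i := l)"] exI[of _ "replace_coord z i x"] conjI) simp_all
qed

section \<open>Integer Chebyshev numbers\<close>

lemma norm_le_sup_norm_on:
  assumes "compact E" "z \<in> E"
  shows "norm (mpoly_eval P z) \<le> sup_norm_on E (mpoly_eval P)"
proof -
  have "continuous_on E (mpoly_eval P)"
    unfolding mpoly_eval_def by (intro continuous_intros)
  then have "compact (mpoly_eval P ` E)" using assms by (intro compact_continuous_image)
  then have "bdd_above (norm ` mpoly_eval P ` E)"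
    by (simp only: bdd_above_norm compact_imp_bounded)
  then have "bdd_above ((\<lambda>z. norm (mpoly_eval P z)) ` E)"
    by (simp only: image_image)
  then show ?thesis unfolding sup_norm_on_def using assms by (intro cSUP_upper)
qed

text \<open>
  Multiplication by a nonnegative constant passes through an infimum; applied twice, this takes the
  submultiplicativity of sup norms to their infima.
\<close>
lemma le_mult_INF:
  fixes f :: "'a \<Rightarrow> real"
  assumes "X \<noteq> {}" "0 \<le> c" "\<And>x. x \<in> X \<Longrightarrow> l \<le> c * f x"
  shows "l \<le> c * (INF x\<in>X. f x)"
proof (cases "c = 0")
  case False
  then have "l / c \<le> (INF x\<in>X. f x)"
    using assms by (intro cINF_greatest) (auto simp: field_simps)
  then show ?thesis using False assms by (simp add: field_simps)
qed (use assms in auto)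

lemma one_in_int_polys: "(1 :: 'd::finite int_mpoly) \<in> int_polys n - {0}"
  by (auto simp: int_polys_def exp_degree_def)

context
  fixes E :: "(complex ^ 'd::finite) set"
  assumes compact: "compact E" and nonempty: "E \<noteq> {}"
begin

lemma sup_norm_on_nonneg: "0 \<le> sup_norm_on E (mpoly_eval P)"
proof -
  obtain z where "z \<in> E" using nonempty by blast
  from norm_le_sup_norm_on[OF compact this] show ?thesis by (rule order_trans[OF norm_ge_zero])
qed

lemma int_cheb_num_le:
  assumes "P \<in> int_polys n - {0}"
  shows "int_cheb_num n E \<le> sup_norm_on E (mpoly_eval P)"
  unfolding int_cheb_num_def using assms sup_norm_on_nonneg
  by (intro cINF_lower bdd_belowI[of _ 0]) auto

lemma int_cheb_num_ge:
  assumes "\<And>P. P \<in> int_polys n \<Longrightarrow> P \<noteq> 0 \<Longrightarrow> \<exists>z\<in>E. l \<le> norm (mpoly_eval P z)"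
  shows "l \<le> int_cheb_num n E"
  unfolding int_cheb_num_def
proof (rule cINF_greatest)
  show "int_polys n - {0} \<noteq> ({} :: 'd int_mpoly set)" using one_in_int_polys by blast
  show "l \<le> sup_norm_on E (mpoly_eval P)" if "P \<in> int_polys n - {0}" for P
  proof -
    obtain z where "z \<in> E" "l \<le> norm (mpoly_eval P z)" using assms[of P] \<open>P \<in> _\<close> by auto
    with norm_le_sup_norm_on[OF compact \<open>z \<in> E\<close>, of P] show ?thesis by linarith
  qed
qed

lemma int_cheb_num_nonneg: "0 \<le> int_cheb_num n E"
  using nonempty by (intro int_cheb_num_ge) auto

lemma int_cheb_num_le_1: "int_cheb_num n E \<le> 1"
proof -
  have "mpoly_eval (1 :: 'd int_mpoly) z = 1" for z by (simp add: mpoly_eval_def lookup_one)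
  then have "sup_norm_on E (mpoly_eval 1) = 1" using nonempty by (simp add: sup_norm_on_def)
  then show ?thesis using int_cheb_num_le[OF one_in_int_polys] by metis
qed

lemma int_cheb_num_submultiplicative:
  "int_cheb_num (m + n) E \<le> int_cheb_num m E * int_cheb_num n E"
proof -
  have *: "int_cheb_num (m + n) E \<le> sup_norm_on E (mpoly_eval P) * sup_norm_on E (mpoly_eval Q)"
    if PQ: "P \<in> int_polys m - {0}" "Q \<in> int_polys n - {0}" for P Q
  proof -
    obtain R where R: "R \<in> int_polys (m + n) - {0}"
        "\<forall>z. mpoly_eval R z = mpoly_eval P z * mpoly_eval Q z"
      using int_poly_prod_nonzero[of P m Q n] PQ by auto
    have "sup_norm_on E (mpoly_eval R) \<le> sup_norm_on E (mpoly_eval P) * sup_norm_on E (mpoly_eval Q)"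
      unfolding sup_norm_on_def[of E "mpoly_eval R"] using nonempty R(2)
      by (intro cSUP_least)
        (auto simp: norm_mult sup_norm_on_nonneg intro!: mult_mono norm_le_sup_norm_on[OF compact])
    then show ?thesis using int_cheb_num_le[OF R(1)] by linarith
  qed
  have ne: "int_polys k - {0} \<noteq> ({} :: 'd int_mpoly set)" for k using one_in_int_polys by blast
  have "int_cheb_num (m + n) E \<le> sup_norm_on E (mpoly_eval P) * int_cheb_num n E"
    if "P \<in> int_polys m - {0}" for P
    unfolding int_cheb_num_def[of n] using that ne sup_norm_on_nonneg * by (intro le_mult_INF)
  then show ?thesis
    unfolding int_cheb_num_def[of m] using ne int_cheb_num_nonneg
    by (subst mult.commute, intro le_mult_INF) (auto simp: mult.commute)
qed

lemma int_cheb_const_ge: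
  assumes "\<And>n. l ^ n \<le> int_cheb_num n E" "0 \<le> l"
  shows "l \<le> int_cheb_const E"
proof -
  have "convergent (\<lambda>n. root n (int_cheb_num n E))"
    by (intro submultiplicative_root_convergent int_cheb_num_nonneg int_cheb_num_le_1
          int_cheb_num_submultiplicative)
  then have "(\<lambda>n. root n (int_cheb_num n E)) \<longlonglongrightarrow> int_cheb_const E"
    by (simp add: int_cheb_const_def convergent_LIMSEQ_iff)
  moreover have "l \<le> root n (int_cheb_num n E)" if "n \<ge> 1" for n
  proof -
    have "l = root n (l ^ n)" using that assms(2) by (simp add: real_root_power_cancel)
    also have "\<dots> \<le> root n (int_cheb_num n E)" using that assms(1) by (intro real_root_le_mono) auto
    finally show ?thesis .
  qed
  ultimately show ?thesis by (intro LIMSEQ_le_const) auto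
qed

end

section \<open>Limits superior along a set\<close>

lemma less_limsup_along:
  assumes "ereal c < limsup_along M f"
  shows "\<exists>m\<in>M. N < m \<and> c < f m"
proof (rule ccontr)
  assume *: "\<not> ?thesis"
  have "ereal (f m) \<le> ereal c" if "N < m" "m \<in> M" for m
    using * that not_less by auto
  then have "\<forall>\<^sub>F m in inf sequentially (principal M). ereal (f m) \<le> ereal c"
    unfolding eventually_inf_principal eventually_sequentially
    by (intro exI[of _ "Suc N"] allI impI) simp
  then have "limsup_along M f \<le> ereal c"
    unfolding limsup_along_def by (rule Limsup_bounded)
  with assms show False by simp
qed

lemma limsup_along_bounds:
  assumes "infinite M" "\<And>m. m \<in> M \<Longrightarrow> l \<le> f m" "\<And>m. m \<in> M \<Longrightarrow> f m \<le> u"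
  shows "ereal l \<le> limsup_along M f" "limsup_along M f \<le> ereal u"
proof -
  have "\<exists>\<^sub>F m in sequentially. m \<in> M"
    using assms(1) by (simp add: frequently_cofinite flip: cofinite_eq_sequentially)
  then have "inf sequentially (principal M) \<noteq> bot"
    unfolding trivial_limit_def eventually_inf_principal by (simp add: frequently_def)
  then show "ereal l \<le> limsup_along M f"
    unfolding limsup_along_def using assms
    by (intro le_Limsup) (auto simp: eventually_inf_principal)
  show "limsup_along M f \<le> ereal u"
    unfolding limsup_along_def using assms
    by (intro Limsup_bounded) (auto simp: eventually_inf_principal)
qed

section \<open>The lower bound\<close>

theorem theorem1p5:
  fixes E :: "(complex ^ 'd::finite) set"
    and M :: "'d \<Rightarrow> nat set"
    and \<Lambda> :: "'d \<Rightarrow> nat \<Rightarrow> complex set"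
    and a :: "'d \<Rightarrow> nat \<Rightarrow> int"
    and s :: "'d \<Rightarrow> ereal"
  assumes "compact E"
    and "\<And>j. infinite (M j)"
    and "\<And>j m. m \<in> M j \<Longrightarrow> complete_conjugate_set (\<Lambda> j m)"
    and "\<And>j m. m \<in> M j \<Longrightarrow> card (\<Lambda> j m) = m"
    and "\<And>m. (\<And>j. m j \<in> M j) \<Longrightarrow> {z. \<forall>j. z $ j \<in> \<Lambda> j (m j)} \<subseteq> E"
    and "\<And>j m. m \<in> M j \<Longrightarrow> \<exists>p. is_min_poly_for p (\<Lambda> j m) \<and> a j m = lead_coeff p"
    and "\<And>j. s j = limsup_along (M j) (\<lambda>m. real_of_int \<bar>a j m\<bar> powr (- 1 / real m))"
  shows "ereal (int_cheb_const E) \<ge> (\<Prod>j\<in>UNIV. s j)"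
proof -
  note card = assms(4) and in_E = assms(5) and min_poly = assms(6)
  define f where "f = (\<lambda>j m. real_of_int \<bar>a j m\<bar> powr (- 1 / real m))"
  have a_ge_1: "1 \<le> real_of_int \<bar>a j m\<bar>" if "m \<in> M j" for j m
  proof -
    from min_poly[OF that] obtain p where "is_min_poly_for p (\<Lambda> j m)" "a j m = lead_coeff p" by blast
    then have "a j m \<noteq> 0" using min_poly_degree_pos by fastforce
    then show ?thesis by (simp flip: of_int_abs)
  qed
  have "f j m \<le> 1" if "m \<in> M j" for j m
    using a_ge_1[OF that] powr_mono[of "- 1 / real m" 0 "real_of_int \<bar>a j m\<bar>"]
    by (simp add: f_def split: if_splits)
  then have s_bounds: "ereal 0 \<le> s j" "s j \<le> ereal 1" for j
    using limsup_along_bounds[OF assms(2)[of j], of 0 "f j" 1] assms(7)[of j] by (auto simp: f_def)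
  define \<sigma> where "\<sigma> = (\<lambda>j. real_of_ereal (s j))"
  have s: "s j = ereal (\<sigma> j)" for j
    using s_bounds[of j] by (cases "s j") (auto simp: \<sigma>_def)
  have \<sigma>_nonneg: "0 \<le> \<sigma> j" for j using s_bounds(1)[of j] by (simp add: s)

  have large_value: "\<exists>z\<in>E. (\<Prod>j\<in>UNIV. c j) ^ n \<le> norm (mpoly_eval P z)"
    if c: "\<And>j. 0 \<le> c j" "\<And>j N. \<exists>m\<in>M j. N < m \<and> c j ^ m * real_of_int \<bar>a j m\<bar> \<le> 1"
      and P: "P \<in> int_polys n" "P \<noteq> 0" for c n P
  proof -
    have "\<exists>m z. (\<forall>j\<in>UNIV. m j \<in> M j \<and> z $ j \<in> \<Lambda> j (m j)) \<and>
        (\<Prod>j\<in>UNIV. c j) ^ n \<le> norm (mpoly_eval P z)"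
      by (rule exists_large_value[OF finite P _ c(1) card min_poly c(2)]) simp_all
    then obtain m z where mz: "\<forall>j\<in>UNIV. m j \<in> M j \<and> z $ j \<in> \<Lambda> j (m j)"
        "(\<Prod>j\<in>UNIV. c j) ^ n \<le> norm (mpoly_eval P z)" by (elim exE conjE)
    have "z \<in> E" using mz(1) by (intro subsetD[OF in_E[of m]]) simp_all
    with mz(2) show ?thesis by blast
  qed
  \<comment> \<open>The constants \<open>c j = 0\<close> are always admissible. They give a point of \<open>E\<close>, and the nonnegativity of
    the Chebyshev constant, which settles the case that some \<open>s j\<close> is zero.\<close>
  have zero_good: "\<exists>m\<in>M j. N < m \<and> (0::real) ^ m * real_of_int \<bar>a j m\<bar> \<le> 1" for j N
  proof -
    obtain m where "N < m" "m \<in> M j" using assms(2)[of j] unfolding infinite_nat_iff_unbounded by blast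
    then show ?thesis by (intro bexI[of _ m]) (simp_all add: zero_power)
  qed
  have "\<exists>z\<in>E. (\<Prod>j\<in>(UNIV :: 'd set). (0::real)) ^ 0 \<le> norm (mpoly_eval 1 z)"
    using one_in_int_polys by (intro large_value zero_good) simp_all
  then have nonempty: "E \<noteq> {}" by blast

  have lower: "(\<Prod>j\<in>UNIV. c j) \<le> int_cheb_const E"
    if c: "\<And>j. 0 \<le> c j" "\<And>j N. \<exists>m\<in>M j. N < m \<and> c j ^ m * real_of_int \<bar>a j m\<bar> \<le> 1" for c
    by (intro int_cheb_const_ge[OF assms(1) nonempty] int_cheb_num_ge[OF assms(1) nonempty]
          large_value[OF c] prod_nonneg ballI c(1))
  have good: "\<exists>m\<in>M j. N < m \<and> c ^ m * real_of_int \<bar>a j m\<bar> \<le> 1"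
    if c: "0 \<le> c" "c < \<sigma> j" for c j N
  proof -
    have "ereal c < limsup_along (M j) (f j)"
      using c(2) s[of j] assms(7)[of j] by (simp add: f_def)
    then obtain m where m: "m \<in> M j" "N < m" "c < f j m" using less_limsup_along by blast
    have "c ^ m \<le> f j m ^ m" using m c(1) by (intro power_mono) auto
    also have "\<dots> = f j m powr real m"
      using a_ge_1[OF m(1)] by (intro powr_realpow[symmetric]) (simp add: f_def)
    also have "\<dots> = real_of_int \<bar>a j m\<bar> powr (- 1)"
      unfolding f_def powr_powr using m(2) by simp
    also have "\<dots> = inverse (real_of_int \<bar>a j m\<bar>)"
      using a_ge_1[OF m(1)] by (simp only: powr_minus) simp
    finally have "c ^ m * real_of_int \<bar>a j m\<bar> \<le> 1"
      using a_ge_1[OF m(1)] by (simp add: field_simps)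
    with m show ?thesis by blast
  qed

  have "(\<Prod>j\<in>UNIV. \<sigma> j) \<le> int_cheb_const E"
  proof (cases "\<exists>j. \<sigma> j = 0")
    case True
    have "0 \<le> int_cheb_const E"
      using lower[of "\<lambda>_. 0", OF _ zero_good] by (simp add: zero_power)
    moreover have "(\<Prod>j\<in>UNIV. \<sigma> j) = 0" using True by (simp add: prod_zero_iff)
    ultimately show ?thesis by linarith
  next
    case False
    then have pos: "\<sigma> j > 0" for j using \<sigma>_nonneg[of j] by (metis less_eq_real_def)
    let ?d = "CARD('d)"
    show ?thesis
    \<comment> \<open>The constants \<open>c j\<close> have to stay below \<open>s j\<close>; shrinking every \<open>s j\<close> by the same factor scales the product by \<open>t\<close>.\<close>
    proof (rule field_le_mult_one_interval)
      fix t :: real assume t: "0 < t" "t < 1"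
      define \<theta> where "\<theta> = root ?d t"
      have \<theta>: "0 < \<theta>" "\<theta> < 1" "\<theta> ^ ?d = t" using t by (auto simp: \<theta>_def)
      have "(\<Prod>j\<in>UNIV. \<theta> * \<sigma> j) \<le> int_cheb_const E"
        using \<theta> pos by (intro lower good) (auto intro: less_imp_le)
      then show "t * (\<Prod>j\<in>UNIV. \<sigma> j) \<le> int_cheb_const E"
        by (simp add: prod.distrib \<theta>(3))
    qed
  qed
  then show ?thesis by (simp add: s prod_ereal)
qed

end
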